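(* Let $(\Omega,\mathcal H,\hat{\mathbb E})$ be a sublinear expectation space, let $0<\underline\sigma^2<\overline\sigma^2$, and let $$\Gamma=\left\{\begin{bmatrix} r_1&0\\0&r_2\end{bmatrix} : r_1,r_2\in[\underline\sigma^2,\overline\sigma^2]\right\}.$$ Let $X=(X_1,X_2)^\top\in\mathcal H^2$ with $X\sim\mathcal N(0,\Gamma)$. Then $X_1$ is not independent from $X_2$ and $X_2$ is not independent from $X_1$.
   Context: $C_{l.Lip}(\mathbb R^n)$ is the set of functions $\varphi:\mathbb R^n\to\mathbb R$ for which there exist $C>0$ and $m\in\mathbb N$ with $|\varphi(x)-\varphi(y)|\le C(1+|x|^m+|y|^m)|x-y|$ for all $x,y\in\mathbb R^n$. Let $\Omega$ be a set and $\mathcal H$ a linear space of real-valued functions on $\Omega$ which contains all constants and contains $\varphi(X_1,\dots,X_n)$ whenever $X_1,\dots,X_n\in\mathcal H$ and $\varphi\in C_{l.Lip}(\mathbb R^n)$. A sublinear expectation is a map $\hat{\mathbb E}:\mathcal H\to\mathbb R$ such that: $\hat{\mathbb E}[X]\le\hat{\mathbb E}[Y]$ if $X\le Y$; $\hat{\mathbb E}[c]=c$ for $c\in\mathbb R$; $\hat{\mathbb E}[X+Y]\le\hat{\mathbb E}[X]+\hat{\mathbb E}[Y]$; $\hat{\mathbb E}[\lambda X]=\lambda\hat{\mathbb E}[X]$ for $\lambda\ge0$. Then $(\Omega,\mathcal H,\hat{\mathbb E})$ is a sublinear expectation space. Elements of $\mathcal H$ are random variables; elements of $\mathcal H^n$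 are $n$-dimensional random vectors. Independence (possibly asymmetric): $Y\in\mathcal H^n$ is independent from $X\in\mathcal H^m$ if $\hat{\mathbb E}[\varphi(X,Y)]=\hat{\mathbb E}\big[\hat{\mathbb E}[\varphi(x,Y)]_{x=X}\big]$ for all $\varphi\in C_{l.Lip}(\mathbb R^{m+n})$. Identical distribution: $X,Y\in\mathcal H^n$ satisfy $X\sim Y$ if $\hat{\mathbb E}[\varphi(X)]=\hat{\mathbb E}[\varphi(Y)]$ for all $\varphi\in C_{l.Lip}(\mathbb R^n)$. If $X\sim\bar X$ and $\bar X$ is independent from $X$, then $\bar X$ is an independent copy of $X$. $G$-normality: $X\in\mathcal H^n$ is $G$-normally distributed (a $G$-normal random vector) if $aX+b\bar X\sim\sqrt{a^2+b^2}\,X$ for all $a,b\ge0$ and any independent copy $\bar X$ of $X$. As usual the independent copy may live on an enlarged (product) sublinear expectation space, so the condition is never vacuous; it means exactly that $\hat{\mathbb E}\big[\hat{\mathbb E}[\varphi(ax+bX)]_{x=X}\big]=\hat{\mathbb E}[\varphi(\sqrt{a^2+b^2}\,X)]$ for all $a,b\ge0$ and $\varphi\in C_{l.Lip}(\mathbb R^n)$. For a bounded, closed, convex subset $\Gamma$ of the positive semidefinite symmetric $n\times n$ matrices, $X\sim\mathcal N(0,\Gamma)$ means that $X$ is an $n$-dimensional $G$-normal random vector with $\frac12\hat{\mathbb E}[\langle AX,X\rangle]=\frac12\sup_{B\in\Gamma}\mathrm{tr}[AB]$ for all symmetric $n\times n$ matrices $A$. ($\Gamma$ is uniquely determined by $X$,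 and determines the distribution of $X$.) *)

theory Defs
  imports "HOL-Analysis.Analysis"
begin

text \<open>
  The growth/Lipschitz condition of \<open>C\<^sub>l\<^sub>.\<^sub>L\<^sub>i\<^sub>p\<close>, relative to a (semi)norm \<open>N\<close>, which is instantiated
  twice: by the norm of a Euclidean space, and by \<^term>\<open>\<lambda>x. L2_set x {..<n}\<close> on
  \<^typ>\<open>nat \<Rightarrow> real\<close>. In the second case the condition forces \<open>\<phi>\<close> to depend on the coordinates
  \<open>i < n\<close> only, so these \<open>\<phi>\<close> are exactly the elements of \<open>C\<^sub>l\<^sub>.\<^sub>L\<^sub>i\<^sub>p(\<real>\<^sup>n)\<close>, with \<open>n\<close> a number
  rather than a type.
\<close>

definition loc_lip_wrt :: "('a::minus \<Rightarrow> real) \<Rightarrow> ('a \<Rightarrow> real) \<Rightarrow> bool" where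
  "loc_lip_wrt N \<phi> \<longleftrightarrow>
     (\<exists>C>0. \<exists>m::nat. \<forall>x y. \<bar>\<phi> x - \<phi> y\<bar> \<le> C * (1 + N x ^ m + N y ^ m) * N (x - y))"

definition C_lLip :: "('a::euclidean_space \<Rightarrow> real) set" where
  "C_lLip = {\<phi>. loc_lip_wrt norm \<phi>}"

definition C_lLip_nat :: "nat \<Rightarrow> ((nat \<Rightarrow> real) \<Rightarrow> real) set" where
  "C_lLip_nat n = {\<phi>. loc_lip_wrt (\<lambda>x. L2_set x {..<n}) \<phi>}"

text \<open>
  The sample space is the type \<^typ>\<open>'w\<close>. \<open>E\<close> is a total HOL function, but is constrained on
  \<open>H\<close> only.
\<close>

locale sublinear_expectation_space =
  fixes H :: "('w \<Rightarrow> real) set" and E :: "('w \<Rightarrow> real) \<Rightarrow> real"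
  assumes const_mem: "(\<lambda>\<omega>. c) \<in> H"
    and add_mem: "X \<in> H \<Longrightarrow> Y \<in> H \<Longrightarrow> (\<lambda>\<omega>. X \<omega> + Y \<omega>) \<in> H"
    and scale_mem: "X \<in> H \<Longrightarrow> (\<lambda>\<omega>. l * X \<omega>) \<in> H"
    and comp_mem: "\<phi> \<in> C_lLip_nat n \<Longrightarrow> (\<And>i. i < n \<Longrightarrow> Z i \<in> H) \<Longrightarrow> (\<lambda>\<omega>. \<phi> (\<lambda>i. Z i \<omega>)) \<in> H"
    and mono: "X \<in> H \<Longrightarrow> Y \<in> H \<Longrightarrow> (\<And>\<omega>. X \<omega> \<le> Y \<omega>) \<Longrightarrow> E X \<le> E Y"
    and const: "E (\<lambda>\<omega>. c) = c"
    and subadd: "X \<in> H \<Longrightarrow> Y \<in> H \<Longrightarrow> E (\<lambda>\<omega>. X \<omega> + Y \<omega>) \<le> E X + E Y"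
    and pos_homog: "X \<in> H \<Longrightarrow> 0 \<le> l \<Longrightarrow> E (\<lambda>\<omega>. l * X \<omega>) = l * E X"

definition random_vector :: "('w \<Rightarrow> real) set \<Rightarrow> ('w \<Rightarrow> 'a::euclidean_space) \<Rightarrow> bool" where
  "random_vector H X \<longleftrightarrow> (\<forall>b\<in>Basis. (\<lambda>\<omega>. X \<omega> \<bullet> b) \<in> H)"

text \<open>\<open>indep_from E Y X\<close>: \<open>Y\<close> is independent from \<open>X\<close> (in this order; the notion is not symmetric).\<close>

definition indep_from ::
  "(('w \<Rightarrow> real) \<Rightarrow> real) \<Rightarrow> ('w \<Rightarrow> 'b::euclidean_space) \<Rightarrow> ('w \<Rightarrow> 'a::euclidean_space) \<Rightarrow> bool" where
  "indep_from E Y X \<longleftrightarrow>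
     (\<forall>\<phi>\<in>C_lLip. E (\<lambda>\<omega>. \<phi> (X \<omega>, Y \<omega>)) = E (\<lambda>\<omega>. E (\<lambda>\<omega>'. \<phi> (X \<omega>, Y \<omega>'))))"

definition ident_distr ::
  "(('w \<Rightarrow> real) \<Rightarrow> real) \<Rightarrow> ('w \<Rightarrow> 'a::euclidean_space) \<Rightarrow> ('w \<Rightarrow> 'a) \<Rightarrow> bool" where
  "ident_distr E X Y \<longleftrightarrow> (\<forall>\<phi>\<in>C_lLip. E (\<lambda>\<omega>. \<phi> (X \<omega>)) = E (\<lambda>\<omega>. \<phi> (Y \<omega>)))"

definition indep_copy ::
  "(('w \<Rightarrow> real) \<Rightarrow> real) \<Rightarrow> ('w \<Rightarrow> 'a::euclidean_space) \<Rightarrow> ('w \<Rightarrow> 'a) \<Rightarrow> bool" where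
  "indep_copy E Y X \<longleftrightarrow> ident_distr E X Y \<and> indep_from E Y X"

text \<open>
  \<open>a X + b X' \<sim> sqrt (a\<^sup>2 + b\<^sup>2) X\<close> for an independent copy \<open>X'\<close> of \<open>X\<close>, where \<open>X'\<close> may live on an
  enlarged space: the law of \<open>a X + b X'\<close> is the iterated expectation on the left, so the
  condition is stated without \<open>X'\<close> and does not become vacuous when the given space carries no
  independent copy. Lemma \<open>is_G_normal_iff\<close> below is the form with an explicit \<open>X'\<close>.
\<close>

definition is_G_normal :: "(('w \<Rightarrow> real) \<Rightarrow> real) \<Rightarrow> ('w \<Rightarrow> 'a::euclidean_space) \<Rightarrow> bool" where
  "is_G_normal E X \<longleftrightarrow>
     (\<forall>a\<ge>0. \<forall>b\<ge>0. \<forall>\<phi>\<in>C_lLip.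
        E (\<lambda>\<omega>. E (\<lambda>\<omega>'. \<phi> (a *\<^sub>R X \<omega> + b *\<^sub>R X \<omega>'))) = E (\<lambda>\<omega>. \<phi> (sqrt (a\<^sup>2 + b\<^sup>2) *\<^sub>R X \<omega>)))"

definition pos_semidef :: "real^'n^'n \<Rightarrow> bool" where
  "pos_semidef B \<longleftrightarrow> transpose B = B \<and> (\<forall>x. 0 \<le> (B *v x) \<bullet> x)"

definition covariance_set :: "(real^'n^'n) set \<Rightarrow> bool" where
  "covariance_set \<Gamma> \<longleftrightarrow>
     \<Gamma> \<noteq> {} \<and> bounded \<Gamma> \<and> closed \<Gamma> \<and> convex \<Gamma> \<and> (\<forall>B\<in>\<Gamma>. pos_semidef B)"

text \<open>\<open>X \<sim> N(0, \<Gamma>)\<close>\<close>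

definition G_normal_distr ::
  "(('w \<Rightarrow> real) \<Rightarrow> real) \<Rightarrow> (real^'n^'n) set \<Rightarrow> ('w \<Rightarrow> real^'n) \<Rightarrow> bool" where
  "G_normal_distr E \<Gamma> X \<longleftrightarrow>
     covariance_set \<Gamma> \<and> is_G_normal E X \<and>
     (\<forall>A. transpose A = A \<longrightarrow>
        1 / 2 * E (\<lambda>\<omega>. (A *v X \<omega>) \<bullet> X \<omega>) = 1 / 2 * (SUP B\<in>\<Gamma>. trace (A ** B)))"

lemma C_lLip_lin_comb:
  fixes \<phi> :: "'a::euclidean_space \<Rightarrow> real"
  assumes "\<phi> \<in> C_lLip"
  shows "(\<lambda>z. \<phi> (a *\<^sub>R fst z + b *\<^sub>R snd z)) \<in> C_lLip"
proof -
  obtain C m where C: "C > 0"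
    and l: "\<And>x y. \<bar>\<phi> x - \<phi> y\<bar> \<le> C * (1 + norm x ^ m + norm y ^ m) * norm (x - y)"
    using assms unfolding C_lLip_def loc_lip_wrt_def by auto
  define K where "K = 1 + \<bar>a\<bar> + \<bar>b\<bar>"
  have K: "K \<ge> 1" unfolding K_def by simp
  let ?L = "\<lambda>z::'a\<times>'a. a *\<^sub>R fst z + b *\<^sub>R snd z"
  have L: "norm (?L z) \<le> K * norm z" for z
  proof -
    have "norm (?L z) \<le> \<bar>a\<bar> * norm (fst z) + \<bar>b\<bar> * norm (snd z)"
      by (metis norm_scaleR norm_triangle_ineq)
    also have "\<dots> \<le> \<bar>a\<bar> * norm z + \<bar>b\<bar> * norm z"
      by (cases z) (auto intro!: add_mono mult_left_mono norm_fst_le norm_snd_le)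
    also have "\<dots> \<le> K * norm z" unfolding K_def by (simp add: algebra_simps)
    finally show ?thesis .
  qed
  have Lm: "norm (?L z) ^ m \<le> K ^ m * norm z ^ m" for z
    using power_mono[OF L[of z], of m] by (simp add: power_mult_distrib)
  have "\<bar>\<phi> (?L x) - \<phi> (?L y)\<bar> \<le> (C * K ^ m * K) * (1 + norm x ^ m + norm y ^ m) * norm (x - y)" for x y
  proof -
    have "1 + norm (?L x) ^ m + norm (?L y) ^ m \<le> K ^ m + K ^ m * norm x ^ m + K ^ m * norm y ^ m"
      using Lm[of x] Lm[of y] one_le_power[OF K, of m] by linarith
    then have A: "C * (1 + norm (?L x) ^ m + norm (?L y) ^ m)
        \<le> C * (K ^ m * (1 + norm x ^ m + norm y ^ m))"
      using C by (intro mult_left_mono) (auto simp: algebra_simps)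
    have "?L x - ?L y = ?L (x - y)" by (simp add: algebra_simps)
    then have B: "norm (?L x - ?L y) \<le> K * norm (x - y)" using L by metis
    have "\<bar>\<phi> (?L x) - \<phi> (?L y)\<bar>
        \<le> C * (1 + norm (?L x) ^ m + norm (?L y) ^ m) * norm (?L x - ?L y)" by (rule l)
    also have "\<dots> \<le> C * (K ^ m * (1 + norm x ^ m + norm y ^ m)) * (K * norm (x - y))"
      using A B C K by (intro mult_mono) auto
    finally show ?thesis by (simp add: mult_ac)
  qed
  moreover have "C * K ^ m * K > 0" using C K by auto
  ultimately show ?thesis unfolding C_lLip_def loc_lip_wrt_def by blast
qed

lemma C_lLip_affine:
  fixes \<phi> :: "'a::euclidean_space \<Rightarrow> real"
  assumes "\<phi> \<in> C_lLip"
  shows "(\<lambda>y. \<phi> (c + b *\<^sub>R y)) \<in> C_lLip"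
proof -
  obtain C m where C: "C > 0"
    and l: "\<And>x y. \<bar>\<phi> x - \<phi> y\<bar> \<le> C * (1 + norm x ^ m + norm y ^ m) * norm (x - y)"
    using C_lLip_lin_comb[OF assms, of 1 b] assms unfolding C_lLip_def loc_lip_wrt_def by auto
  define K where "K = 1 + norm c + \<bar>b\<bar>"
  have K: "K \<ge> 1" unfolding K_def by simp
  have P: "norm (c + b *\<^sub>R y) ^ m \<le> K ^ m * (1 + norm y) ^ m" for y
  proof -
    have "norm (c + b *\<^sub>R y) \<le> norm c + \<bar>b\<bar> * norm y"
      by (metis norm_scaleR norm_triangle_ineq)
    also have "\<dots> \<le> K * (1 + norm y)" unfolding K_def by (simp add: algebra_simps)
    finally show ?thesis by (metis norm_ge_zero power_mono power_mult_distrib)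
  qed
  have Q: "(1 + norm y) ^ m \<le> 2 ^ m * (1 + norm y ^ m)" for y :: 'a
  proof -
    have "(1 + norm y) ^ m \<le> (2 * max 1 (norm y)) ^ m" by (intro power_mono) auto
    also have "\<dots> = 2 ^ m * (max 1 (norm y)) ^ m" by (simp add: power_mult_distrib)
    also have "\<dots> \<le> 2 ^ m * (1 + norm y ^ m)" by (intro mult_left_mono) (auto simp: max_def)
    finally show ?thesis .
  qed
  define D where "D = K ^ m * 2 ^ m"
  have D: "D \<ge> 1" unfolding D_def using K by (metis mult_ge1_I one_le_numeral one_le_power)
  have R: "norm (c + b *\<^sub>R y) ^ m \<le> D * (1 + norm y ^ m)" for y
    using order_trans[OF P mult_left_mono[OF Q]] K unfolding D_def by (simp add: mult.assoc)
  have "\<bar>\<phi> (c + b *\<^sub>R x) - \<phi> (c + b *\<^sub>R y)\<bar>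
      \<le> (C * (3 * D) * K) * (1 + norm x ^ m + norm y ^ m) * norm (x - y)" for x y
  proof -
    have "1 + norm (c + b *\<^sub>R x) ^ m + norm (c + b *\<^sub>R y) ^ m
        \<le> D + D * (1 + norm x ^ m) + D * (1 + norm y ^ m)"
      using R[of x] R[of y] D by linarith
    also have "\<dots> = 3 * D + D * norm x ^ m + D * norm y ^ m" by (simp add: algebra_simps)
    also have "\<dots> \<le> 3 * D + 3 * D * norm x ^ m + 3 * D * norm y ^ m"
      using D by (intro add_mono mult_right_mono) auto
    finally have A: "C * (1 + norm (c + b *\<^sub>R x) ^ m + norm (c + b *\<^sub>R y) ^ m)
        \<le> C * (3 * D * (1 + norm x ^ m + norm y ^ m))"
      using C by (intro mult_left_mono) (auto simp: algebra_simps)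
    have "(c + b *\<^sub>R x) - (c + b *\<^sub>R y) = b *\<^sub>R (x - y)" by (simp add: algebra_simps)
    then have B: "norm ((c + b *\<^sub>R x) - (c + b *\<^sub>R y)) \<le> K * norm (x - y)"
      unfolding K_def by (simp add: mult_right_mono)
    have "\<bar>\<phi> (c + b *\<^sub>R x) - \<phi> (c + b *\<^sub>R y)\<bar>
        \<le> C * (1 + norm (c + b *\<^sub>R x) ^ m + norm (c + b *\<^sub>R y) ^ m)
            * norm ((c + b *\<^sub>R x) - (c + b *\<^sub>R y))" by (rule l)
    also have "\<dots> \<le> C * (3 * D * (1 + norm x ^ m + norm y ^ m)) * (K * norm (x - y))"
      using A B C D K by (intro mult_mono) auto
    finally show ?thesis by (simp add: mult_ac)
  qed
  moreover have "C * (3 * D) * K > 0" using C K D by auto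
  ultimately show ?thesis unfolding C_lLip_def loc_lip_wrt_def by blast
qed

lemma is_G_normal_iff:
  assumes "indep_copy E X' X"
  shows "is_G_normal E X \<longleftrightarrow>
    (\<forall>a\<ge>0. \<forall>b\<ge>0. ident_distr E (\<lambda>\<omega>. a *\<^sub>R X \<omega> + b *\<^sub>R X' \<omega>) (\<lambda>\<omega>. sqrt (a\<^sup>2 + b\<^sup>2) *\<^sub>R X \<omega>))"
proof -
  have "E (\<lambda>\<omega>. \<phi> (a *\<^sub>R X \<omega> + b *\<^sub>R X' \<omega>)) = E (\<lambda>\<omega>. E (\<lambda>\<omega>'. \<phi> (a *\<^sub>R X \<omega> + b *\<^sub>R X \<omega>')))"
    if \<phi>: "\<phi> \<in> C_lLip" for \<phi> a b
  proof -
    have "E (\<lambda>\<omega>. \<phi> (a *\<^sub>R X \<omega> + b *\<^sub>R X' \<omega>)) = E (\<lambda>\<omega>. E (\<lambda>\<omega>'. \<phi> (a *\<^sub>R X \<omega> + b *\<^sub>R X' \<omega>')))"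
      using assms C_lLip_lin_comb[OF \<phi>, of a b]
      unfolding indep_copy_def indep_from_def by force
    moreover have "E (\<lambda>\<omega>'. \<phi> (c + b *\<^sub>R X' \<omega>')) = E (\<lambda>\<omega>'. \<phi> (c + b *\<^sub>R X \<omega>'))" for c
      using assms C_lLip_affine[OF \<phi>, of c b]
      unfolding indep_copy_def ident_distr_def by force
    ultimately show ?thesis by simp
  qed
  then show ?thesis unfolding is_G_normal_def ident_distr_def by auto
qed

end

theory Submission
  imports Defs
begin

text \<open>
  The idea is to test independence on the single function \<open>\<phi>(u, v) = u\<^sup>2 v\<close>. Let \<open>U\<close>, \<open>V\<close> be the two
  coordinates of \<open>X\<close> in either order, and suppose that \<open>V\<close> is independent from \<open>U\<close>. A centred \<open>V\<close>
  has no mean uncertainty, so \<open>E[U\<^sup>2 V] = E[E[x\<^sup>2 V]\<^bsub>x=U\<^esub>] = 0\<close>.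

  Stability of the \<open>G\<close>-normal law with \<open>a = b = 1\<close> computes the same quantity differently. With a
  copy \<open>(U', V')\<close> of \<open>(U, V)\<close> that is independent from \<open>(U, V)\<close>, it says that
  \<open>2\<surd>2 E[U\<^sup>2 V] = E[(U + U')\<^sup>2 (V + V')]\<close>. Integrate out the copy first. The terms linear in \<open>U'\<close>, \<open>V'\<close> or \<open>U'V'\<close> contribute nothing,
  and what survives besides \<open>U\<^sup>2 V\<close> is \<open>E[v U'\<^sup>2 + U'\<^sup>2 V']\<close> at \<open>v = V\<close>, which by independence is
  \<open>E[v U\<^sup>2] = \<sigma>\<^sub>l\<^sub>o\<^sup>2 v + (\<sigma>\<^sub>h\<^sub>i\<^sup>2 - \<sigma>\<^sub>l\<^sub>o\<^sup>2) v\<^sup>+\<close>: the best variance of \<open>U'\<close> depends on the sign of \<open>V\<close>.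
  Hence \<open>2\<surd>2 E[U\<^sup>2 V] = (\<sigma>\<^sub>h\<^sub>i\<^sup>2 - \<sigma>\<^sub>l\<^sub>o\<^sup>2) E[V\<^sup>+]\<close>, again by independence. The right-hand
  side is positive because \<open>E[V\<^sup>+] = E\<bar>V\<bar> / 2\<close> and \<open>E[V\<^sup>2] > 0\<close>, whereas the left-hand side is zero.

  In control terms, under the \<open>G\<close>-normal law the volatility of each coordinate may react to the
  other coordinate during the whole time interval, whereas independence of \<open>V\<close> from \<open>U\<close> forbids
  that of \<open>U\<close> to react to \<open>V\<close>. The argument is carried by \<open>not_indep_from_of_stable_cubic\<close>, with
  \<open>E_abs_pos\<close> for the final strict inequality.
\<close>

section \<open>Test functions\<close>

text \<open>Stability and independence are tested on functions of this form only. The factor \<open>q x + c\<close>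
  comes from shifting the second coordinate, and the Lipschitz term \<open>h\<close> is there to hold the
  variable \<open>E[v U\<^sup>2]\<close> at \<open>v = V\<close>, which is piecewise linear in \<open>V\<close>.\<close>

lemma C_lLip_square_mult:
  fixes p q h :: "'a::euclidean_space \<Rightarrow> real"
  assumes p: "linear p" "\<And>x. \<bar>p x\<bar> \<le> norm x"
    and q: "linear q" "\<And>x. \<bar>q x\<bar> \<le> norm x"
    and h: "K \<ge> 0" "\<And>x y. \<bar>h x - h y\<bar> \<le> K * norm (x - y)"
  shows "(\<lambda>x. (p x)\<^sup>2 * (q x + c) + h x) \<in> C_lLip"
proof -
  have "\<bar>((p x)\<^sup>2 * (q x + c) + h x) - ((p y)\<^sup>2 * (q y + c) + h y)\<bar>
      \<le> (2 + \<bar>c\<bar> + K) * (1 + norm x ^ 2 + norm y ^ 2) * norm (x - y)" for x y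
  proof -
    let ?a = "norm x" and ?b = "norm y" and ?d = "norm (x - y)"
    have pd: "\<bar>p x - p y\<bar> \<le> ?d" and qd: "\<bar>q x - q y\<bar> \<le> ?d"
      using p(2)[of "x - y"] q(2)[of "x - y"] by (simp_all add: linear_diff p(1) q(1))
    have ps: "\<bar>p x + p y\<bar> \<le> ?a + ?b" using p(2)[of x] p(2)[of y] by linarith
    have sq: "\<bar>(p x)\<^sup>2 - (p y)\<^sup>2\<bar> \<le> (?a + ?b) * ?d"
    proof -
      have "(p x)\<^sup>2 - (p y)\<^sup>2 = (p x + p y) * (p x - p y)" by (simp add: power2_eq_square algebra_simps)
      then show ?thesis using mult_mono[OF ps pd] by (simp add: abs_mult)
    qed
    have qc: "\<bar>q x + c\<bar> \<le> ?a + \<bar>c\<bar>" using q(2)[of x] by linarith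
    have py: "(p y)\<^sup>2 \<le> ?b\<^sup>2" using p(2)[of y] by (metis abs_ge_zero power2_abs power_mono)
    have "((p x)\<^sup>2 * (q x + c) + h x) - ((p y)\<^sup>2 * (q y + c) + h y)
        = ((p x)\<^sup>2 - (p y)\<^sup>2) * (q x + c) + (p y)\<^sup>2 * (q x - q y) + (h x - h y)"
      by (simp add: algebra_simps)
    also have "\<bar>\<dots>\<bar> \<le> \<bar>((p x)\<^sup>2 - (p y)\<^sup>2) * (q x + c)\<bar> + \<bar>(p y)\<^sup>2 * (q x - q y)\<bar> + \<bar>h x - h y\<bar>"
      by linarith
    also have "\<dots> \<le> ((?a + ?b) * ?d) * (?a + \<bar>c\<bar>) + ?b\<^sup>2 * ?d + K * ?d"
    proof (intro add_mono)
      show "\<bar>((p x)\<^sup>2 - (p y)\<^sup>2) * (q x + c)\<bar> \<le> ((?a + ?b) * ?d) * (?a + \<bar>c\<bar>)"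
        unfolding abs_mult by (intro mult_mono sq qc) auto
      show "\<bar>(p y)\<^sup>2 * (q x - q y)\<bar> \<le> ?b\<^sup>2 * ?d"
        using mult_mono[OF py qd] by (simp add: abs_mult)
    qed (rule h(2))
    also have "\<dots> = ((?a\<^sup>2 + ?a * ?b + ?b\<^sup>2) + \<bar>c\<bar> * (?a + ?b) + K) * ?d"
      by (simp add: power2_eq_square algebra_simps)
    also have "\<dots> \<le> (2 * (1 + ?a\<^sup>2 + ?b\<^sup>2) + \<bar>c\<bar> * (1 + ?a\<^sup>2 + ?b\<^sup>2) + K * (1 + ?a\<^sup>2 + ?b\<^sup>2)) * ?d"
    proof -
      have ab: "?a * ?b \<le> ?a\<^sup>2 + ?b\<^sup>2"
        using sum_squares_bound[of ?a ?b] mult_nonneg_nonneg[OF norm_ge_zero[of x] norm_ge_zero[of y]] by linarith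
      have a1: "?a \<le> 1 / 2 + ?a\<^sup>2" and b1: "?b \<le> 1 / 2 + ?b\<^sup>2"
        using zero_le_power2[of "?a - 1 / 2"] zero_le_power2[of "?b - 1 / 2"]
        by (auto simp: power2_eq_square algebra_simps)
      have "?a\<^sup>2 + ?a * ?b + ?b\<^sup>2 \<le> 2 * (1 + ?a\<^sup>2 + ?b\<^sup>2)" using ab by (simp add: algebra_simps)
      moreover have "\<bar>c\<bar> * (?a + ?b) \<le> \<bar>c\<bar> * (1 + ?a\<^sup>2 + ?b\<^sup>2)"
        using a1 b1 by (intro mult_left_mono) auto
      moreover have "K * 1 \<le> K * (1 + ?a\<^sup>2 + ?b\<^sup>2)"
        using h(1) by (intro mult_left_mono) auto
      ultimately show ?thesis by (intro mult_right_mono) auto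
    qed
    finally show ?thesis by (simp add: algebra_simps)
  qed
  moreover have "2 + \<bar>c\<bar> + K > 0" using h(1) by linarith
  ultimately show ?thesis unfolding C_lLip_def loc_lip_wrt_def by blast
qed

lemma C_lLip_linear:
  fixes h :: "'a::euclidean_space \<Rightarrow> real"
  assumes "linear h" "\<And>x. \<bar>h x\<bar> \<le> norm x"
  shows "h \<in> C_lLip"
proof -
  have "\<bar>h x - h y\<bar> \<le> 1 * norm (x - y)" for x y
    using assms(2)[of "x - y"] by (simp add: linear_diff[OF assms(1)])
  from C_lLip_square_mult[where p = "\<lambda>x::'a. 0" and q = "\<lambda>x. 0" and c = 0, OF _ _ _ _ _ this]
  show ?thesis by (simp add: linear_zero)
qed

section \<open>Sublinear expectations\<close>

context sublinear_expectation_space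
begin

lemma diff_mem: "X \<in> H \<Longrightarrow> Y \<in> H \<Longrightarrow> (\<lambda>\<omega>. X \<omega> - Y \<omega>) \<in> H"
  using add_mem[OF _ scale_mem[where l = "- 1"]] by simp

lemma uminus_mem: "X \<in> H \<Longrightarrow> (\<lambda>\<omega>. - X \<omega>) \<in> H"
  using scale_mem[where l = "- 1"] by simp

lemma abs_mem:
  assumes "X \<in> H" shows "(\<lambda>\<omega>. \<bar>X \<omega>\<bar>) \<in> H"
proof -
  have "\<bar>\<bar>x\<bar> - \<bar>y\<bar>\<bar> \<le> 3 * \<bar>x - y\<bar>" for x y :: real
    by (rule order_trans[OF abs_triangle_ineq3]) simp
  then have "(\<lambda>z. \<bar>z 0\<bar>) \<in> C_lLip_nat 1"
    unfolding C_lLip_nat_def loc_lip_wrt_def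
    by (intro CollectI exI[of _ 1] conjI exI[of _ 0]) (auto simp: L2_set_def lessThan_Suc)
  from comp_mem[OF this, of "\<lambda>_. X"] assms show ?thesis by simp
qed

lemma square_mem:
  assumes "X \<in> H" shows "(\<lambda>\<omega>. (X \<omega>)\<^sup>2) \<in> H"
proof -
  have "\<bar>x\<^sup>2 - y\<^sup>2\<bar> \<le> (1 + \<bar>x\<bar> + \<bar>y\<bar>) * \<bar>x - y\<bar>" for x y :: real
  proof -
    have "\<bar>x\<^sup>2 - y\<^sup>2\<bar> = \<bar>x + y\<bar> * \<bar>x - y\<bar>"
      by (simp add: power2_eq_square algebra_simps flip: abs_mult)
    also have "\<dots> \<le> (1 + \<bar>x\<bar> + \<bar>y\<bar>) * \<bar>x - y\<bar>" by (intro mult_right_mono) auto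
    finally show ?thesis .
  qed
  then have "(\<lambda>z. (z 0)\<^sup>2) \<in> C_lLip_nat 1"
    unfolding C_lLip_nat_def loc_lip_wrt_def
    by (intro CollectI exI[of _ 1] conjI exI[of _ 1]) (auto simp: L2_set_def lessThan_Suc)
  from comp_mem[OF this, of "\<lambda>_. X"] assms show ?thesis by simp
qed

lemma mult_mem:
  assumes "X \<in> H" "Y \<in> H" shows "(\<lambda>\<omega>. X \<omega> * Y \<omega>) \<in> H"
proof -
  have "(\<lambda>\<omega>. 1 / 4 * ((X \<omega> + Y \<omega>)\<^sup>2 - (X \<omega> - Y \<omega>)\<^sup>2)) \<in> H"
    by (intro scale_mem diff_mem square_mem add_mem assms)
  moreover have "1 / 4 * ((x + y)\<^sup>2 - (x - y)\<^sup>2) = x * y" for x y :: real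
    by (simp add: power2_eq_square algebra_simps)
  ultimately show ?thesis by simp
qed

lemmas mem_intros = const_mem add_mem diff_mem uminus_mem mult_mem square_mem abs_mem

lemma E_mult_null:
  assumes Z: "Z \<in> H" "E Z = 0" "E (\<lambda>\<omega>. - Z \<omega>) = 0"
  shows "E (\<lambda>\<omega>. c * Z \<omega>) = 0"
proof (cases "c \<ge> 0")
  case True
  then show ?thesis using pos_homog[OF Z(1), of c] Z(2) by simp
next
  case False
  then show ?thesis using pos_homog[OF uminus_mem[OF Z(1)], of "- c"] Z(3) by simp
qed

text \<open>A random variable without mean uncertainty can be dropped, since subadditivity then bounds the
  expectation of the sum from both sides. This replaces the linearity which \<open>E\<close> lacks.\<close>

lemma E_add_null:
  assumes Y: "Y \<in> H" and Z: "Z \<in> H" "E Z = 0" "E (\<lambda>\<omega>. - Z \<omega>) = 0"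
  shows "E (\<lambda>\<omega>. Y \<omega> + c * Z \<omega>) = E Y"
proof (rule antisym)
  show "E (\<lambda>\<omega>. Y \<omega> + c * Z \<omega>) \<le> E Y"
    using subadd[OF Y scale_mem[OF Z(1), of c]] E_mult_null[OF Z, of c] by simp
  have "E (\<lambda>\<omega>. (Y \<omega> + c * Z \<omega>) + (- c) * Z \<omega>) \<le> E (\<lambda>\<omega>. Y \<omega> + c * Z \<omega>) + E (\<lambda>\<omega>. (- c) * Z \<omega>)"
    by (intro subadd mem_intros Y Z(1))
  then show "E Y \<le> E (\<lambda>\<omega>. Y \<omega> + c * Z \<omega>)"
    using E_mult_null[OF Z, of "- c"] by simp
qed

lemma E_add_const:
  assumes Y: "Y \<in> H"
  shows "E (\<lambda>\<omega>. c + Y \<omega>) = c + E Y"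
proof (rule antisym)
  show "E (\<lambda>\<omega>. c + Y \<omega>) \<le> c + E Y"
    using subadd[OF const_mem[of c] Y] const[of c] by simp
  show "c + E Y \<le> E (\<lambda>\<omega>. c + Y \<omega>)"
    using subadd[OF const_mem[of "- c"] add_mem[OF const_mem[of c] Y]] const[of "- c"] by simp
qed

text \<open>A variable of positive second moment cannot have \<open>E\<bar>V\<bar> = 0\<close>, because the fourth moment is
  finite: the second moment is interpolated between the first and the fourth one, and the parameter
  \<open>l\<close> is chosen so small that the fourth moment does not matter.\<close>

lemma E_abs_pos:
  assumes V: "V \<in> H" and pos: "E (\<lambda>\<omega>. (V \<omega>)\<^sup>2) > 0"
  shows "E (\<lambda>\<omega>. \<bar>V \<omega>\<bar>) > 0"
proof (rule ccontr)
  define m M where "m = E (\<lambda>\<omega>. (V \<omega>)\<^sup>2)" and "M = E (\<lambda>\<omega>. ((V \<omega>)\<^sup>2)\<^sup>2)"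
  assume "\<not> ?thesis"
  then have le0: "E (\<lambda>\<omega>. \<bar>V \<omega>\<bar>) \<le> 0" by simp
  have M: "M \<ge> 0"
    unfolding M_def using mono[OF const_mem[of 0] square_mem[OF square_mem[OF V]]] const[of 0] by simp
  define l where "l = sqrt (m / (M + 1))"
  have l: "l > 0" and l2: "l\<^sup>2 = m / (M + 1)"
    using pos M unfolding l_def m_def by auto
  have cube: "t \<le> 1 + t ^ 3" if "t \<ge> 0" for t :: real
  proof (cases "t \<le> 1")
    case False
    then have "t ^ 1 \<le> t ^ 3" by (intro power_increasing) auto
    then show ?thesis by simp
  qed (use that zero_le_power[of t 3] in linarith)
  have bound: "l * v\<^sup>2 \<le> \<bar>v\<bar> + l ^ 3 * (v\<^sup>2)\<^sup>2" for v :: real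
  proof -
    have "\<bar>v\<bar> * (l * \<bar>v\<bar>) \<le> \<bar>v\<bar> * (1 + (l * \<bar>v\<bar>) ^ 3)"
      using l by (intro mult_left_mono cube) auto
    moreover have "\<bar>v\<bar> * (l * \<bar>v\<bar>) = l * v\<^sup>2" by (simp add: power2_eq_square)
    moreover have "\<bar>v\<bar> * (1 + (l * \<bar>v\<bar>) ^ 3) = \<bar>v\<bar> + l ^ 3 * (\<bar>v\<bar>\<^sup>2)\<^sup>2"
      by (simp only: power2_eq_square power3_eq_cube) (simp add: algebra_simps)
    ultimately show ?thesis by simp
  qed
  have "l * m = E (\<lambda>\<omega>. l * (V \<omega>)\<^sup>2)"
    unfolding m_def using l by (simp add: pos_homog[OF square_mem[OF V]])
  also have "\<dots> \<le> E (\<lambda>\<omega>. \<bar>V \<omega>\<bar> + l ^ 3 * ((V \<omega>)\<^sup>2)\<^sup>2)"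
    by (intro mono mem_intros V bound)
  also have "\<dots> \<le> E (\<lambda>\<omega>. \<bar>V \<omega>\<bar>) + E (\<lambda>\<omega>. l ^ 3 * ((V \<omega>)\<^sup>2)\<^sup>2)"
    by (intro subadd mem_intros V)
  also have "\<dots> \<le> l ^ 3 * M"
    unfolding M_def using le0 pos_homog[OF square_mem[OF square_mem[OF V]], of "l ^ 3"]
      zero_le_power[OF less_imp_le[OF l], of 3] by linarith
  also have "\<dots> = l * (m * (M / (M + 1)))"
    using l2 by (simp add: power3_eq_cube power2_eq_square)
  finally have "m \<le> m * (M / (M + 1))" using mult_le_cancel_left_pos[OF l] by blast
  moreover have "m * (M / (M + 1)) < m * 1"
    using pos M unfolding m_def by (intro mult_strict_left_mono) auto
  ultimately show False by simp
qed

section \<open>Asymmetry of the cubic moment\<close>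

text \<open>The function \<open>c \<mapsto> E[c U\<^sup>2]\<close> has a kink at \<open>0\<close>, which is where variance uncertainty
  enters: \<open>V\<close> has no mean uncertainty, but \<open>E[c U\<^sup>2]\<close> at \<open>c = V\<close> has positive expectation. So
  adding an independent increment strictly raises \<open>E[U\<^sup>2 V]\<close>, which is \<open>0\<close> if \<open>V\<close> is
  independent from \<open>U\<close>. This contradicts the scaling law \<open>stable\<close>.\<close>

lemma not_indep_from_of_stable_cubic:
  assumes U: "U \<in> H" "E U = 0" "E (\<lambda>\<omega>. - U \<omega>) = 0"
    and V: "V \<in> H" "E V = 0" "E (\<lambda>\<omega>. - V \<omega>) = 0"
    and UV: "E (\<lambda>\<omega>. U \<omega> * V \<omega>) = 0" "E (\<lambda>\<omega>. - (U \<omega> * V \<omega>)) = 0"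
    and s: "s < s'"
    and var: "\<And>c. E (\<lambda>\<omega>. c * (U \<omega>)\<^sup>2) = s * c + (s' - s) * max c 0"
    and V2: "E (\<lambda>\<omega>. (V \<omega>)\<^sup>2) > 0"
    and stable: "E (\<lambda>\<omega>. E (\<lambda>\<omega>'. (U \<omega> + U \<omega>')\<^sup>2 * (V \<omega> + V \<omega>'))) = \<kappa> * E (\<lambda>\<omega>. (U \<omega>)\<^sup>2 * V \<omega>)"
  shows "\<not> indep_from E V U"
proof
  assume indep: "indep_from E V U"
  \<comment> \<open>One family of test functions serves twice: with \<open>c\<close> alone for the inner expectation in the
    stability identity, with \<open>d\<close> and \<open>e\<close> for the outer one.\<close>
  have fubini: "E (\<lambda>\<omega>. (U \<omega>)\<^sup>2 * (V \<omega> + c) + (d * V \<omega> + e * \<bar>V \<omega>\<bar>))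
      = E (\<lambda>\<omega>. E (\<lambda>\<omega>'. (U \<omega>)\<^sup>2 * (V \<omega>' + c) + (d * V \<omega>' + e * \<bar>V \<omega>'\<bar>)))" for c d e
  proof -
    have "\<bar>(d * snd x + e * \<bar>snd x\<bar>) - (d * snd y + e * \<bar>snd y\<bar>)\<bar> \<le> (\<bar>d\<bar> + \<bar>e\<bar>) * norm (x - y)"
      for x y :: "real \<times> real"
    proof -
      have n: "\<bar>snd x - snd y\<bar> \<le> norm (x - y)"
        using norm_snd_le[of "snd x - snd y" "fst x - fst y"] by (simp add: minus_prod_def)
      have "(d * snd x + e * \<bar>snd x\<bar>) - (d * snd y + e * \<bar>snd y\<bar>)
          = d * (snd x - snd y) + e * (\<bar>snd x\<bar> - \<bar>snd y\<bar>)" by (simp add: algebra_simps)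
      also have "\<bar>\<dots>\<bar> \<le> \<bar>d\<bar> * \<bar>snd x - snd y\<bar> + \<bar>e\<bar> * \<bar>\<bar>snd x\<bar> - \<bar>snd y\<bar>\<bar>"
        by (metis abs_mult abs_triangle_ineq)
      also have "\<dots> \<le> \<bar>d\<bar> * norm (x - y) + \<bar>e\<bar> * norm (x - y)"
        using n by (intro add_mono mult_left_mono) auto
      finally show ?thesis by (simp add: algebra_simps)
    qed
    moreover have "\<bar>fst x\<bar> \<le> norm x" "\<bar>snd x\<bar> \<le> norm x" for x :: "real \<times> real"
      by (metis norm_fst_le norm_snd_le prod.collapse real_norm_def)+
    ultimately have "(\<lambda>z::real \<times> real. (fst z)\<^sup>2 * (snd z + c) + (d * snd z + e * \<bar>snd z\<bar>)) \<in> C_lLip"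
      by (intro C_lLip_square_mult[where K = "\<bar>d\<bar> + \<bar>e\<bar>"])
        (auto intro: linear_fst linear_snd)
    then show ?thesis using indep unfolding indep_from_def by force
  qed
  have expand: "E (\<lambda>\<omega>. (U \<omega>)\<^sup>2 * (V \<omega> + c) + (d * V \<omega> + e * \<bar>V \<omega>\<bar>))
      = E (\<lambda>\<omega>. c * (U \<omega>)\<^sup>2 + E (\<lambda>\<omega>'. e * \<bar>V \<omega>'\<bar>))" for c d e
  proof -
    have "E (\<lambda>\<omega>'. u\<^sup>2 * (V \<omega>' + c) + (d * V \<omega>' + e * \<bar>V \<omega>'\<bar>)) = c * u\<^sup>2 + E (\<lambda>\<omega>'. e * \<bar>V \<omega>'\<bar>)"
      for u
    proof -
      have "E (\<lambda>\<omega>'. u\<^sup>2 * (V \<omega>' + c) + (d * V \<omega>' + e * \<bar>V \<omega>'\<bar>))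
          = E (\<lambda>\<omega>'. (c * u\<^sup>2 + e * \<bar>V \<omega>'\<bar>) + (u\<^sup>2 + d) * V \<omega>')" by (simp add: algebra_simps)
      also have "\<dots> = E (\<lambda>\<omega>'. c * u\<^sup>2 + e * \<bar>V \<omega>'\<bar>)"
        by (intro E_add_null mem_intros V)
      also have "\<dots> = c * u\<^sup>2 + E (\<lambda>\<omega>'. e * \<bar>V \<omega>'\<bar>)"
        by (intro E_add_const mem_intros V)
      finally show ?thesis .
    qed
    then show ?thesis unfolding fubini by simp
  qed
  have cubic_zero: "E (\<lambda>\<omega>. (U \<omega>)\<^sup>2 * V \<omega>) = 0"
    using expand[of 0 0 0] const[of 0] by simp
  \<comment> \<open>A fixed first argument \<open>(u, v)\<close>. The term \<open>v U\<^sup>2\<close> must stay together with \<open>U\<^sup>2 V\<close>: neither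
    is free of uncertainty, and only independence evaluates their sum.\<close>
  have inner: "E (\<lambda>\<omega>'. (u + U \<omega>')\<^sup>2 * (v + V \<omega>')) = u\<^sup>2 * v + (s * v + (s' - s) * max v 0)" for u v
  proof -
    have "E (\<lambda>\<omega>'. (u + U \<omega>')\<^sup>2 * (v + V \<omega>'))
        = E (\<lambda>\<omega>'. (((u\<^sup>2 * v + (U \<omega>')\<^sup>2 * (V \<omega>' + v)) + u\<^sup>2 * V \<omega>') + 2 * u * v * U \<omega>')
            + 2 * u * (U \<omega>' * V \<omega>'))"
      by (simp add: power2_eq_square algebra_simps)
    also have "\<dots> = E (\<lambda>\<omega>'. ((u\<^sup>2 * v + (U \<omega>')\<^sup>2 * (V \<omega>' + v)) + u\<^sup>2 * V \<omega>') + 2 * u * v * U \<omega>')"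
      by (intro E_add_null UV mem_intros U V)
    also have "\<dots> = E (\<lambda>\<omega>'. (u\<^sup>2 * v + (U \<omega>')\<^sup>2 * (V \<omega>' + v)) + u\<^sup>2 * V \<omega>')"
      by (intro E_add_null U mem_intros V)
    also have "\<dots> = E (\<lambda>\<omega>'. u\<^sup>2 * v + (U \<omega>')\<^sup>2 * (V \<omega>' + v))"
      by (intro E_add_null V mem_intros U)
    also have "\<dots> = u\<^sup>2 * v + E (\<lambda>\<omega>'. (U \<omega>')\<^sup>2 * (V \<omega>' + v))"
      by (intro E_add_const mem_intros U V)
    also have "E (\<lambda>\<omega>'. (U \<omega>')\<^sup>2 * (V \<omega>' + v)) = s * v + (s' - s) * max v 0"
      using expand[of v 0 0] const[of 0] var[of v] by simp
    finally show ?thesis .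
  qed
  have max_abs: "max v 0 = (v + \<bar>v\<bar>) / 2" for v :: real by auto
  define e where "e = (s' - s) / 2"
  have e: "e > 0" using s unfolding e_def by simp
  have "E (\<lambda>\<omega>. E (\<lambda>\<omega>'. (U \<omega> + U \<omega>')\<^sup>2 * (V \<omega> + V \<omega>')))
      = E (\<lambda>\<omega>. (U \<omega>)\<^sup>2 * (V \<omega> + 0) + ((s + e) * V \<omega> + e * \<bar>V \<omega>\<bar>))"
  proof -
    have "u\<^sup>2 * v + (s * v + (s' - s) * ((v + \<bar>v\<bar>) / 2))
        = u\<^sup>2 * (v + 0) + ((s + e) * v + e * \<bar>v\<bar>)" for u v
      unfolding e_def by (simp add: field_simps)
    then show ?thesis unfolding inner max_abs by simp
  qed
  also have "\<dots> = e * E (\<lambda>\<omega>. \<bar>V \<omega>\<bar>)"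
    unfolding expand using const e by (simp add: pos_homog[OF abs_mem[OF V(1)]])
  also have "\<dots> > 0" using e E_abs_pos[OF V(1) V2] by simp
  finally show False using stable cubic_zero by simp
qed

end

section \<open>The moments of the G-normal vector\<close>

lemma random_vector_nth:
  fixes X :: "'w \<Rightarrow> real^'n"
  assumes "random_vector H X"
  shows "(\<lambda>\<omega>. X \<omega> $ i) \<in> H"
proof -
  have "axis i 1 \<in> (Basis :: (real^'n) set)" by (auto simp: Basis_vec_def)
  then show ?thesis using assms unfolding random_vector_def by (fastforce simp: inner_axis)
qed

lemma is_G_normal_double:
  assumes "is_G_normal E X" "\<phi> \<in> C_lLip"
  shows "E (\<lambda>\<omega>. E (\<lambda>\<omega>'. \<phi> (X \<omega> + X \<omega>'))) = E (\<lambda>\<omega>. \<phi> (sqrt 2 *\<^sub>R X \<omega>))"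
  using assms(1)[unfolded is_G_normal_def, rule_format, of 1 1 \<phi>] assms(2) by simp

text \<open>As \<open>X\<close> and its copy have the same mean, stability forces \<open>2 E[L X] = \<surd>2 E[L X]\<close> for every linear functional
  \<open>L\<close>. Both signs of \<open>c\<close> are needed to exclude mean uncertainty.\<close>

lemma is_G_normal_mean_zero:
  fixes X :: "'w \<Rightarrow> real^'n"
  assumes S: "sublinear_expectation_space H E" and X: "random_vector H X" and G: "is_G_normal E X"
    and c: "\<bar>c\<bar> = 1"
  shows "E (\<lambda>\<omega>. c * X \<omega> $ i) = 0"
proof -
  interpret sublinear_expectation_space H E by (rule S)
  let ?L = "\<lambda>x::real^'n. c * x $ i"
  have L: "?L \<in> C_lLip"
    using c by (intro C_lLip_linear linearI) (auto simp: algebra_simps abs_mult component_le_norm_cart)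
  have M: "(\<lambda>\<omega>. c * X \<omega> $ i) \<in> H" by (intro scale_mem random_vector_nth X)
  have "E (\<lambda>\<omega>. E (\<lambda>\<omega>'. ?L (X \<omega> + X \<omega>'))) = E (\<lambda>\<omega>. ?L (sqrt 2 *\<^sub>R X \<omega>))"
    by (rule is_G_normal_double[OF G L])
  moreover have "E (\<lambda>\<omega>. ?L (sqrt 2 *\<^sub>R X \<omega>)) = sqrt 2 * E (\<lambda>\<omega>. c * X \<omega> $ i)"
    using pos_homog[OF M, of "sqrt 2"] by (simp add: algebra_simps)
  moreover have "E (\<lambda>\<omega>. E (\<lambda>\<omega>'. ?L (X \<omega> + X \<omega>'))) = 2 * E (\<lambda>\<omega>. c * X \<omega> $ i)"
    using E_add_const[OF M] E_add_const[OF M, of "E (\<lambda>\<omega>. c * X \<omega> $ i)"]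
    by (simp add: algebra_simps)
  ultimately have "(2 - sqrt 2) * E (\<lambda>\<omega>. c * X \<omega> $ i) = 0" by (simp add: algebra_simps)
  moreover have "sqrt 2 < 2" using real_sqrt_less_mono[of 2 4] by simp
  ultimately show ?thesis by simp
qed

lemma is_G_normal_cubic:
  fixes X :: "'w \<Rightarrow> real^'n"
  assumes S: "sublinear_expectation_space H E" and X: "random_vector H X" and G: "is_G_normal E X"
  shows "E (\<lambda>\<omega>. E (\<lambda>\<omega>'. (X \<omega> $ i + X \<omega>' $ i)\<^sup>2 * (X \<omega> $ j + X \<omega>' $ j)))
       = 2 * sqrt 2 * E (\<lambda>\<omega>. (X \<omega> $ i)\<^sup>2 * X \<omega> $ j)"
proof -
  interpret sublinear_expectation_space H E by (rule S)
  let ?L = "\<lambda>x::real^'n. (x $ i)\<^sup>2 * (x $ j)"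
  have L: "?L \<in> C_lLip"
    using C_lLip_square_mult[where p = "\<lambda>x::real^'n. x $ i" and q = "\<lambda>x. x $ j" and h = "\<lambda>_. 0"
        and c = 0 and K = 0]
    by (simp add: linearI component_le_norm_cart)
  have M: "(\<lambda>\<omega>. (X \<omega> $ i)\<^sup>2 * X \<omega> $ j) \<in> H" by (intro mem_intros random_vector_nth X)
  have "E (\<lambda>\<omega>. E (\<lambda>\<omega>'. ?L (X \<omega> + X \<omega>'))) = E (\<lambda>\<omega>. ?L (sqrt 2 *\<^sub>R X \<omega>))"
    by (rule is_G_normal_double[OF G L])
  moreover have "E (\<lambda>\<omega>. ?L (sqrt 2 *\<^sub>R X \<omega>)) = 2 * sqrt 2 * E (\<lambda>\<omega>. (X \<omega> $ i)\<^sup>2 * X \<omega> $ j)"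
    using pos_homog[OF M, of "2 * sqrt 2"] by (simp add: power_mult_distrib algebra_simps)
  ultimately show ?thesis by simp
qed

lemma G_normal_distr_box_quadratic:
  fixes X :: "'w \<Rightarrow> real^2" and lo hi a b d :: real
  assumes lohi: "lo \<le> hi"
    and G: "G_normal_distr E {vector [vector [r1, 0], vector [0, r2]] | r1 r2.
               r1 \<in> {lo..hi} \<and> r2 \<in> {lo..hi}} X"
  shows "E (\<lambda>\<omega>. a * (X \<omega> $ 1)\<^sup>2 + 2 * b * (X \<omega> $ 1 * X \<omega> $ 2) + d * (X \<omega> $ 2)\<^sup>2)
       = (lo * a + (hi - lo) * max a 0) + (lo * d + (hi - lo) * max d 0)"
    (is "_ = ?g a + ?g d")
proof -
  let ?\<Gamma> = "{vector [vector [r1, 0], vector [0, r2]] | r1 r2. r1 \<in> {lo..hi} \<and> r2 \<in> {lo..hi}} :: (real^2^2) set"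
  define A :: "real^2^2" where "A = vector [vector [a, b], vector [b, d]]"
  have "transpose A = A"
    unfolding A_def transpose_def by (simp add: vec_eq_iff forall_2 vector_2)
  then have "E (\<lambda>\<omega>. (A *v X \<omega>) \<bullet> X \<omega>) = (SUP B\<in>?\<Gamma>. trace (A ** B))"
    using G unfolding G_normal_distr_def by auto
  moreover have "(A *v x) \<bullet> x = a * (x $ 1)\<^sup>2 + 2 * b * (x $ 1 * x $ 2) + d * (x $ 2)\<^sup>2" for x
    unfolding A_def
    by (simp add: inner_vec_def matrix_vector_mult_def sum_2 vector_2 power2_eq_square algebra_simps)
  moreover have tr: "trace (A ** vector [vector [r1, 0], vector [0, r2]]) = a * r1 + d * r2" for r1 r2
    unfolding A_def by (simp add: trace_def matrix_matrix_mult_def sum_2 vector_2)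
  moreover have "(SUP B\<in>?\<Gamma>. trace (A ** B)) = ?g a + ?g d"
  proof (rule cSup_eq_maximum)
    \<comment> \<open>Each diagonal entry is extremal independently of the other, by the sign of its coefficient.\<close>
    let ?r = "\<lambda>c::real. if c \<ge> 0 then hi else lo"
    have "a * ?r a + d * ?r d = ?g a + ?g d" by (auto simp: algebra_simps max_def)
    moreover have "vector [vector [?r a, 0], vector [0, ?r d]] \<in> ?\<Gamma>" using lohi by fastforce
    ultimately show "?g a + ?g d \<in> (\<lambda>B. trace (A ** B)) ` ?\<Gamma>"
      by (metis (no_types, lifting) image_eqI tr)
  next
    have g: "c * r \<le> ?g c" if "r \<in> {lo..hi}" for c r :: real
    proof (cases "c \<ge> 0")
      case True
      then have "c * r \<le> c * hi" using that by (intro mult_left_mono) auto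
      then show ?thesis using True by (simp add: algebra_simps)
    next
      case False
      then have "c * r \<le> c * lo" using that by (intro mult_left_mono_neg) auto
      then show ?thesis using False by (simp add: algebra_simps)
    qed
    fix y assume "y \<in> (\<lambda>B. trace (A ** B)) ` ?\<Gamma>"
    then obtain r1 r2 where "r1 \<in> {lo..hi}" "r2 \<in> {lo..hi}" "y = a * r1 + d * r2"
      using tr by auto
    then show "y \<le> ?g a + ?g d" using g[of r1 a] g[of r2 d] by simp
  qed
  ultimately show ?thesis by simp
qed

theorem theorem4p4:
  fixes H :: "('w \<Rightarrow> real) set" and E :: "('w \<Rightarrow> real) \<Rightarrow> real"
    and \<sigma>_lo \<sigma>_hi :: real and \<Gamma> :: "(real^2^2) set" and X :: "'w \<Rightarrow> real^2"
  assumes "sublinear_expectation_space H E"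
    and "0 < \<sigma>_lo\<^sup>2" and "\<sigma>_lo\<^sup>2 < \<sigma>_hi\<^sup>2"
    and "\<Gamma> = {vector [vector [r1, 0], vector [0, r2]] | r1 r2.
               r1 \<in> {\<sigma>_lo\<^sup>2..\<sigma>_hi\<^sup>2} \<and> r2 \<in> {\<sigma>_lo\<^sup>2..\<sigma>_hi\<^sup>2}}"
    and "random_vector H X"
    and "G_normal_distr E \<Gamma> X"
  shows "\<not> indep_from E (\<lambda>\<omega>. X \<omega> $ 1) (\<lambda>\<omega>. X \<omega> $ 2) \<and>
         \<not> indep_from E (\<lambda>\<omega>. X \<omega> $ 2) (\<lambda>\<omega>. X \<omega> $ 1)"
proof -
  interpret sublinear_expectation_space H E by (rule assms(1))
  have G: "is_G_normal E X" using assms(6) unfolding G_normal_distr_def by blast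
  note mem = random_vector_nth[OF assms(5)]
  have mean: "E (\<lambda>\<omega>. X \<omega> $ i) = 0" "E (\<lambda>\<omega>. - X \<omega> $ i) = 0" for i
    using is_G_normal_mean_zero[OF assms(1,5) G, of 1] is_G_normal_mean_zero[OF assms(1,5) G, of "- 1"]
    by simp_all
  note quadratic = G_normal_distr_box_quadratic[OF less_imp_le[OF assms(3)] assms(6)[unfolded assms(4)]]
  have cov: "E (\<lambda>\<omega>. X \<omega> $ 1 * X \<omega> $ 2) = 0" "E (\<lambda>\<omega>. - (X \<omega> $ 1 * X \<omega> $ 2)) = 0"
    using quadratic[of 0 "1 / 2" 0] quadratic[of 0 "- 1 / 2" 0] by simp_all
  have var1: "E (\<lambda>\<omega>. c * (X \<omega> $ 1)\<^sup>2) = \<sigma>_lo\<^sup>2 * c + (\<sigma>_hi\<^sup>2 - \<sigma>_lo\<^sup>2) * max c 0" for c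
    using quadratic[of c 0 0] by simp
  have var2: "E (\<lambda>\<omega>. c * (X \<omega> $ 2)\<^sup>2) = \<sigma>_lo\<^sup>2 * c + (\<sigma>_hi\<^sup>2 - \<sigma>_lo\<^sup>2) * max c 0" for c
    using quadratic[of 0 0 c] by simp
  have pos1: "E (\<lambda>\<omega>. (X \<omega> $ 1)\<^sup>2) > 0" and pos2: "E (\<lambda>\<omega>. (X \<omega> $ 2)\<^sup>2) > 0"
    using var1[of 1] var2[of 1] less_trans[OF assms(2,3)] by simp_all
  show ?thesis
  proof
    show "\<not> indep_from E (\<lambda>\<omega>. X \<omega> $ 1) (\<lambda>\<omega>. X \<omega> $ 2)"
      using cov by (intro not_indep_from_of_stable_cubic[OF _ _ _ _ _ _ _ _ assms(3) var2 pos1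
            is_G_normal_cubic[OF assms(1,5) G]] mem mean) (simp_all add: mult.commute)
    show "\<not> indep_from E (\<lambda>\<omega>. X \<omega> $ 2) (\<lambda>\<omega>. X \<omega> $ 1)"
      by (intro not_indep_from_of_stable_cubic[OF _ _ _ _ _ _ _ _ assms(3) var1 pos2
            is_G_normal_cubic[OF assms(1,5) G]] mem mean cov)
  qed
qed

end
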